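(* Let $X$ be a graph admitting a pair of disjoint automorphisms $\sigma,\tau\in\mathrm{Aut}(X)$, and assume that $k\in\mathbb N$ does not exceed the order of either of these automorphisms (that is, $k\le\min(\mathrm{ord}(\sigma),\mathrm{ord}(\tau))$, where orders may be infinite). Then $X$ admits an irreducible quantum automorphism of dimension $k$. In particular, if $\mathrm{Aut}(X)$ contains a pair of nontrivial disjoint automorphisms then $X$ has quantum symmetry.
   Context: Graphs $X=(V_X,E_X)$ are undirected, simple, without loops, possibly infinite: $E_X\subset V_X\times V_X$ is symmetric and $(v,v)\notin E_X$. $\mathrm{Aut}(X)$ is the group of permutations of $V_X$ preserving adjacency. Two automorphisms $\sigma,\tau\in\mathrm{Aut}(X)$ are disjoint if for all $x\in V_X$: $\sigma(x)\ne x$ implies $\tau(x)=x$, and $\tau(x)\neq x$ implies $\sigma(x)=x$. Let $\mathrm{rel}(v,w)\in\{\text{equal},\text{adjacent},\text{distinct and non-adjacent}\}$ denote the adjacency relation of $v,w\in V_X$. A quantum automorphism of $X$ is a pair $(\mathcal H,u)$ of a Hilbert space and a family $u=(u_{xy})_{x,y\in V_X}$ of projections in $B(\mathcal H)$ such that each row and each column consists of pairwise orthogonal projections summing to $1$ in the strong operator topology, and such that $u_{x_1y_1}u_{x_2y_2}=0$ whenever $\mathrm{rel}(x_1,x_2)\neq\mathrm{rel}(y_1,y_2)$. It is irreducible if the only bounded operators on $\mathcal H$ commuting with all $u_{xy}$ are scalar multiples of the identity; its dimension is $\dim\mathcal H$. A graph has quantum symmetry if it admits an irreducible quantum automorphism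 which is not one-dimensional. *)

theory Defs
  imports
    "HOL-Analysis.Analysis"
    "HOL-Algebra.Module"
    "HOL-Algebra.Bij"
    "HOL-Algebra.Multiplicative_Group"
    "HOL-Library.Extended_Nat"
begin

section \<open>Graphs and their automorphisms\<close>

definition simple_graph :: "'v set \<Rightarrow> ('v \<times> 'v) set \<Rightarrow> bool" where
  "simple_graph V E \<longleftrightarrow> E \<subseteq> V \<times> V \<and> sym E \<and> irrefl E"

definition aut_group :: "'v set \<Rightarrow> ('v \<times> 'v) set \<Rightarrow> ('v \<Rightarrow> 'v) monoid" where
  "aut_group V E = BijGroup V
     \<lparr>carrier := {\<sigma> \<in> Bij V. \<forall>x\<in>V. \<forall>y\<in>V. (\<sigma> x, \<sigma> y) \<in> E \<longleftrightarrow> (x, y) \<in> E}\<rparr>"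

text \<open>\<^const>\<open>group.ord\<close> is \<open>0\<close> on elements of infinite order.\<close>
definition elem_order :: "('g, 'b) monoid_scheme \<Rightarrow> 'g \<Rightarrow> enat" where
  "elem_order G g = (if group.ord G g = 0 then \<infinity> else enat (group.ord G g))"

definition disjoint_auts :: "'v set \<Rightarrow> ('v \<Rightarrow> 'v) \<Rightarrow> ('v \<Rightarrow> 'v) \<Rightarrow> bool" where
  "disjoint_auts V \<sigma> \<tau> \<longleftrightarrow>
     (\<forall>x\<in>V. (\<sigma> x \<noteq> x \<longrightarrow> \<tau> x = x) \<and> (\<tau> x \<noteq> x \<longrightarrow> \<sigma> x = x))"

datatype adjacency = Equal | Adjacent | Nonadjacent

definition rel :: "('v \<times> 'v) set \<Rightarrow> 'v \<Rightarrow> 'v \<Rightarrow> adjacency" where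
  "rel E v w = (if v = w then Equal else if (v, w) \<in> E then Adjacent else Nonadjacent)"


section \<open>Complex Hilbert spaces\<close>

text \<open>
  The dimension of the Hilbert space is quantified in what follows, so Hilbert spaces are
  structures with an explicit carrier rather than members of a type class.  Of the ring
  structure that \<^type>\<open>module\<close> inherits from \<^type>\<open>ring\<close>, the multiplication
  and the unit are irrelevant.
\<close>

definition complex_field :: "complex ring" where
  "complex_field = \<lparr>carrier = UNIV, mult = (*), one = 1, zero = 0, add = (+)\<rparr>"

record 'h hilbert = "(complex, 'h) module" +
  cinner :: "'h \<Rightarrow> 'h \<Rightarrow> complex"

definition hnorm :: "('h, 'b) hilbert_scheme \<Rightarrow> 'h \<Rightarrow> real" where
  "hnorm H x = sqrt (Re (cinner H x x))"

locale hilbert_space = Module.module complex_field H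
  for H :: "('h, 'b) hilbert_scheme" (structure) +
  assumes cinner_commute:
      "\<lbrakk>x \<in> carrier H; y \<in> carrier H\<rbrakk> \<Longrightarrow> cinner H y x = cnj (cinner H x y)"
    and cinner_add_left:
      "\<lbrakk>x \<in> carrier H; y \<in> carrier H; z \<in> carrier H\<rbrakk>
       \<Longrightarrow> cinner H (x \<oplus>\<^bsub>H\<^esub> y) z = cinner H x z + cinner H y z"
    and cinner_scale_left:
      "\<lbrakk>x \<in> carrier H; y \<in> carrier H\<rbrakk> \<Longrightarrow> cinner H (c \<odot>\<^bsub>H\<^esub> x) y = c * cinner H x y"
    and cinner_nonneg: "x \<in> carrier H \<Longrightarrow> 0 \<le> Re (cinner H x x)"
    and cinner_definite: "\<lbrakk>x \<in> carrier H; cinner H x x = 0\<rbrakk> \<Longrightarrow> x = \<zero>\<^bsub>H\<^esub>"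
    and complete:
      "\<lbrakk>\<And>n. s n \<in> carrier H;
        \<And>\<epsilon>. \<epsilon> > 0 \<Longrightarrow> \<exists>N. \<forall>m\<ge>N. \<forall>n\<ge>N. hnorm H (s m \<ominus>\<^bsub>H\<^esub> s n) < \<epsilon>\<rbrakk>
       \<Longrightarrow> \<exists>x\<in>carrier H. (\<lambda>n::nat. hnorm H (s n \<ominus>\<^bsub>H\<^esub> x)) \<longlonglongrightarrow> 0"

definition orthonormal_basis :: "('h, 'b) hilbert_scheme \<Rightarrow> 'h set \<Rightarrow> bool" where
  "orthonormal_basis H B \<longleftrightarrow>
     B \<subseteq> carrier H \<and>
     (\<forall>b\<in>B. \<forall>b'\<in>B. cinner H b b' = (if b = b' then 1 else 0)) \<and>
     (\<forall>x\<in>carrier H. (\<forall>b\<in>B. cinner H x b = 0) \<longrightarrow> x = \<zero>\<^bsub>H\<^esub>)"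

definition has_dimension :: "('h, 'b) hilbert_scheme \<Rightarrow> nat \<Rightarrow> bool" where
  "has_dimension H k \<longleftrightarrow> (\<exists>B. orthonormal_basis H B \<and> finite B \<and> card B = k)"

text \<open>Operators are functions of which only the values on \<^const>\<open>carrier\<close> matter.\<close>
definition bounded_op :: "('h, 'b) hilbert_scheme \<Rightarrow> ('h \<Rightarrow> 'h) \<Rightarrow> bool" where
  "bounded_op H T \<longleftrightarrow>
     T \<in> carrier H \<rightarrow> carrier H \<and>
     (\<forall>x\<in>carrier H. \<forall>y\<in>carrier H. T (x \<oplus>\<^bsub>H\<^esub> y) = T x \<oplus>\<^bsub>H\<^esub> T y) \<and>
     (\<forall>c. \<forall>x\<in>carrier H. T (c \<odot>\<^bsub>H\<^esub> x) = c \<odot>\<^bsub>H\<^esub> T x) \<and>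
     (\<exists>C. \<forall>x\<in>carrier H. hnorm H (T x) \<le> C * hnorm H x)"

definition projection :: "('h, 'b) hilbert_scheme \<Rightarrow> ('h \<Rightarrow> 'h) \<Rightarrow> bool" where
  "projection H P \<longleftrightarrow>
     bounded_op H P \<and>
     (\<forall>x\<in>carrier H. P (P x) = P x) \<and>
     (\<forall>x\<in>carrier H. \<forall>y\<in>carrier H. cinner H (P x) y = cinner H x (P y))"

text \<open>The operators \<open>T i\<close>, \<open>i \<in> I\<close>, sum to the identity in the strong
  operator topology: the net of finite partial sums converges pointwise in norm.\<close>
definition sot_sums_to_one :: "('h, 'b) hilbert_scheme \<Rightarrow> ('i \<Rightarrow> 'h \<Rightarrow> 'h) \<Rightarrow> 'i set \<Rightarrow> bool" where
  "sot_sums_to_one H T I \<longleftrightarrow>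
     (\<forall>\<xi>\<in>carrier H.
        ((\<lambda>F. hnorm H ((\<Oplus>\<^bsub>H\<^esub>i\<in>F. T i \<xi>) \<ominus>\<^bsub>H\<^esub> \<xi>)) \<longlongrightarrow> 0) (finite_subsets_at_top I))"

definition pairwise_orthogonal :: "('h, 'b) hilbert_scheme \<Rightarrow> ('i \<Rightarrow> 'h \<Rightarrow> 'h) \<Rightarrow> 'i set \<Rightarrow> bool" where
  "pairwise_orthogonal H T I \<longleftrightarrow>
     (\<forall>i\<in>I. \<forall>j\<in>I. i \<noteq> j \<longrightarrow> (\<forall>\<xi>\<in>carrier H. T i (T j \<xi>) = \<zero>\<^bsub>H\<^esub>))"


section \<open>Quantum automorphisms\<close>

definition quantum_automorphism ::
  "'v set \<Rightarrow> ('v \<times> 'v) set \<Rightarrow> ('h, 'b) hilbert_scheme \<Rightarrow> ('v \<Rightarrow> 'v \<Rightarrow> 'h \<Rightarrow> 'h) \<Rightarrow> bool" where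
  "quantum_automorphism V E H u \<longleftrightarrow>
     hilbert_space H \<and>
     (\<forall>x\<in>V. \<forall>y\<in>V. projection H (u x y)) \<and>
     (\<forall>x\<in>V. pairwise_orthogonal H (\<lambda>y. u x y) V \<and> sot_sums_to_one H (\<lambda>y. u x y) V) \<and>
     (\<forall>y\<in>V. pairwise_orthogonal H (\<lambda>x. u x y) V \<and> sot_sums_to_one H (\<lambda>x. u x y) V) \<and>
     (\<forall>x1\<in>V. \<forall>x2\<in>V. \<forall>y1\<in>V. \<forall>y2\<in>V. rel E x1 x2 \<noteq> rel E y1 y2 \<longrightarrow>
        (\<forall>\<xi>\<in>carrier H. u x1 y1 (u x2 y2 \<xi>) = \<zero>\<^bsub>H\<^esub>))"

text \<open>As usual for irreducibility, the Hilbert space is required to be nonzero; otherwise every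
  graph would have quantum symmetry, by its zero-dimensional quantum automorphism.\<close>
definition irreducible_quantum_automorphism ::
  "'v set \<Rightarrow> ('v \<times> 'v) set \<Rightarrow> ('h, 'b) hilbert_scheme \<Rightarrow> ('v \<Rightarrow> 'v \<Rightarrow> 'h \<Rightarrow> 'h) \<Rightarrow> bool" where
  "irreducible_quantum_automorphism V E H u \<longleftrightarrow>
     quantum_automorphism V E H u \<and>
     carrier H \<noteq> {\<zero>\<^bsub>H\<^esub>} \<and>
     (\<forall>T. bounded_op H T \<and>
          (\<forall>x\<in>V. \<forall>y\<in>V. \<forall>\<xi>\<in>carrier H. T (u x y \<xi>) = u x y (T \<xi>))
        \<longrightarrow> (\<exists>c. \<forall>\<xi>\<in>carrier H. T \<xi> = c \<odot>\<^bsub>H\<^esub> \<xi>))"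

text \<open>
  HOL cannot quantify existentially over types, so the two notions below let the Hilbert space range
  over all structures whose carrier lies in one fixed type.  That type is large enough to lose
  nothing: in an irreducible quantum automorphism every nonzero vector is cyclic for the algebra
  generated by the operators \<open>u x y\<close>, so the space has a dense subset of cardinality at most
  \<open>\<kappa> = max(card V, aleph_0)\<close> and hence at most \<open>\<kappa> ^ aleph_0 \<le> 2 ^ \<kappa>\<close> elements,
  and transports to a subset of \<open>'v \<times> nat \<Rightarrow> complex\<close>.
\<close>

definition admits_irreducible_of_dimension :: "'v set \<Rightarrow> ('v \<times> 'v) set \<Rightarrow> nat \<Rightarrow> bool" where
  "admits_irreducible_of_dimension V E k \<longleftrightarrow>
     (\<exists>(H :: ('v \<times> nat \<Rightarrow> complex) hilbert) u.
        irreducible_quantum_automorphism V E H u \<and> has_dimension H k)"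

definition has_quantum_symmetry :: "'v set \<Rightarrow> ('v \<times> 'v) set \<Rightarrow> bool" where
  "has_quantum_symmetry V E \<longleftrightarrow>
     (\<exists>(H :: ('v \<times> nat \<Rightarrow> complex) hilbert) u.
        irreducible_quantum_automorphism V E H u \<and> \<not> has_dimension H 1)"

end

theory Submission
  imports Defs
begin

text \<open>
  On \<open>\<complex>\<^sup>k\<close> take the rank-one projections \<open>p_n\<close> onto the coordinate axes, \<open>n < k\<close>, and the
  projection \<open>q\<close> onto the line spanned by the all-ones vector \<open>w\<close>.  Vertices moved by \<open>\<sigma>\<close> are
  sent to \<open>\<sigma>\<^sup>n x\<close> with weight \<open>p_n\<close>, all other vertices are kept with weight \<open>q\<close> and moved by
  \<open>\<tau>\<close> with weight \<open>1 - q\<close>; disjointness makes these two classical families compatible with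
  adjacency although \<open>p_n\<close> and \<open>q\<close> do not commute.  An operator in the commutant is diagonal,
  because the powers \<open>\<sigma>\<^sup>n\<close> with \<open>n < k\<close> are distinguished by their values on vertices, and has
  \<open>w\<close> as an eigenvector, because \<open>q\<close> is the entry at \<open>(x, x)\<close> of any vertex \<open>x\<close> moved by \<open>\<tau>\<close>.
  Hence it is a scalar.
\<close>

section \<open>The automorphism group\<close>

lemma aut_group_simps [simp]:
  "carrier (aut_group V E) = {\<sigma> \<in> Bij V. \<forall>x\<in>V. \<forall>y\<in>V. (\<sigma> x, \<sigma> y) \<in> E \<longleftrightarrow> (x, y) \<in> E}"
  "\<one>\<^bsub>aut_group V E\<^esub> = (\<lambda>x\<in>V. x)"
  "\<sigma> \<otimes>\<^bsub>aut_group V E\<^esub> \<tau> = (\<lambda>\<sigma>\<in>Bij V. \<lambda>\<tau>\<in>Bij V. compose V \<sigma> \<tau>) \<sigma> \<tau>"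
  by (simp_all add: aut_group_def BijGroup_def)

lemma Bij_mem: "\<sigma> \<in> Bij V \<Longrightarrow> x \<in> V \<Longrightarrow> \<sigma> x \<in> V"
  by (auto dest: Bij_imp_funcset)

lemma group_aut_group: "group (aut_group V E)"
  unfolding aut_group_def
proof (rule subgroup.subgroup_is_group[OF _ group_BijGroup])
  let ?A = "{\<sigma> \<in> Bij V. \<forall>x\<in>V. \<forall>y\<in>V. (\<sigma> x, \<sigma> y) \<in> E \<longleftrightarrow> (x, y) \<in> E}"
  show "subgroup ?A (BijGroup V)"
  proof (rule group.subgroupI[OF group_BijGroup])
    show "?A \<subseteq> carrier (BijGroup V)" by (auto simp: BijGroup_def)
    have "(\<lambda>x\<in>V. x) \<in> ?A" by (simp add: id_Bij)
    then show "?A \<noteq> {}" by blast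
  next
    fix \<sigma> assume \<sigma>: "\<sigma> \<in> ?A"
    have inv: "inv_into V \<sigma> x \<in> V" "\<sigma> (inv_into V \<sigma> x) = x" if "x \<in> V" for x
      using \<sigma> that by (auto simp: Bij_def bij_betw_def inv_into_into f_inv_into_f)
    have "(inv_into V \<sigma> x, inv_into V \<sigma> y) \<in> E \<longleftrightarrow> (x, y) \<in> E" if "x \<in> V" "y \<in> V" for x y
      using \<sigma> inv[OF that(1)] inv[OF that(2)] by (smt (verit) mem_Collect_eq)
    then show "inv\<^bsub>BijGroup V\<^esub> \<sigma> \<in> ?A"
      using \<sigma> by (simp add: inv_BijGroup restrict_inv_into_Bij)
  next
    fix \<sigma> \<tau> assume "\<sigma> \<in> ?A" "\<tau> \<in> ?A"
    then show "\<sigma> \<otimes>\<^bsub>BijGroup V\<^esub> \<tau> \<in> ?A"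
      by (auto simp: BijGroup_def compose_Bij compose_eq Bij_mem)
  qed
qed

lemma funpow_aut:
  assumes "\<sigma> \<in> carrier (aut_group V E)" "x \<in> V"
  shows "(\<sigma> ^^ n) x \<in> V"
  using assms by (induction n) (auto intro: Bij_mem)

lemma funpow_aut_edge:
  assumes "\<sigma> \<in> carrier (aut_group V E)" "x \<in> V" "y \<in> V"
  shows "((\<sigma> ^^ n) x, (\<sigma> ^^ n) y) \<in> E \<longleftrightarrow> (x, y) \<in> E"
proof (induction n)
  case (Suc n)
  then show ?case
    using assms(1) funpow_aut[OF assms(1,2), of n] funpow_aut[OF assms(1,3), of n] by auto
qed simp

lemma bij_betw_funpow_aut:
  assumes "\<sigma> \<in> carrier (aut_group V E)"
  shows "bij_betw (\<sigma> ^^ n) V V"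
  using assms by (intro bij_betw_funpow) (auto simp: Bij_def)

text \<open>Translates statements about orders in the group, whose elements are restricted to
  \<open>V\<close>, into statements about iterates, with which the rest of the proof
  computes.\<close>

lemma pow_aut_group:
  assumes "\<sigma> \<in> carrier (aut_group V E)"
  shows "\<sigma> [^]\<^bsub>aut_group V E\<^esub> (n::nat) = restrict (\<sigma> ^^ n) V"
proof (induction n)
  case 0
  then show ?case by (simp add: restrict_def)
next
  case (Suc n)
  interpret group "aut_group V E" by (rule group_aut_group)
  have "\<sigma> [^]\<^bsub>aut_group V E\<^esub> n \<in> Bij V"
    using nat_pow_closed[OF assms, of n] by simp
  then show ?case
    using assms Suc by (auto simp: compose_def restrict_def Bij_mem funpow_swap1 intro!: ext)
qed

lemma aut_power_moves:
  assumes "\<sigma> \<in> carrier (aut_group V E)" "0 < n" "enat n < elem_order (aut_group V E) \<sigma>"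
  shows "\<exists>x\<in>V. (\<sigma> ^^ n) x \<noteq> x"
proof (rule ccontr)
  interpret group "aut_group V E" by (rule group_aut_group)
  assume "\<not> ?thesis"
  then have "\<sigma> [^]\<^bsub>aut_group V E\<^esub> n = \<one>\<^bsub>aut_group V E\<^esub>"
    using pow_aut_group[OF assms(1)] by (auto simp: restrict_def)
  then have "ord \<sigma> dvd n"
    using pow_eq_id assms(1) by blast
  \<comment> \<open>For infinite order \<open>ord \<sigma>\<close> is 0, which divides no positive
    \<open>n\<close>; for finite order divisibility would give
    \<open>ord \<sigma> \<le> n\<close>.\<close>
  then show False
    using assms(2,3) by (auto simp: elem_order_def dest: dvd_imp_le split: if_splits)
qed

lemma two_le_elem_order:
  assumes "\<sigma> \<in> carrier (aut_group V E)" "\<sigma> \<noteq> \<one>\<^bsub>aut_group V E\<^esub>"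
  shows "enat 2 \<le> elem_order (aut_group V E) \<sigma>"
proof -
  interpret group "aut_group V E" by (rule group_aut_group)
  have "ord \<sigma> \<noteq> 1"
    using assms ord_eq_1 by blast
  then show ?thesis
    unfolding elem_order_def by (cases "ord \<sigma> = 0") auto
qed

section \<open>Functions with finite support\<close>

text \<open>For finite \<open>S\<close> these are the coordinate vectors indexed by
  \<open>S\<close>. Taking total functions that vanish off \<open>S\<close> keeps all dimensions
  inside one type and turns equality on \<open>S\<close> into equality of functions.\<close>

definition l2_space :: "'i set \<Rightarrow> ('i \<Rightarrow> complex) hilbert" where
  "l2_space S = \<lparr>carrier = {f. \<forall>i. i \<notin> S \<longrightarrow> f i = 0}, mult = (\<lambda>f g. undefined),
     one = undefined, zero = (\<lambda>_. 0), add = (\<lambda>f g i. f i + g i),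
     smult = (\<lambda>c f i. c * f i), cinner = (\<lambda>f g. \<Sum>i\<in>S. f i * cnj (g i))\<rparr>"

lemma l2_simps [simp]:
  "f \<in> carrier (l2_space S) \<longleftrightarrow> (\<forall>i. i \<notin> S \<longrightarrow> f i = 0)"
  "\<zero>\<^bsub>l2_space S\<^esub> = (\<lambda>_. 0)"
  "f \<oplus>\<^bsub>l2_space S\<^esub> g = (\<lambda>i. f i + g i)"
  "c \<odot>\<^bsub>l2_space S\<^esub> f = (\<lambda>i. c * f i)"
  "cinner (l2_space S) f g = (\<Sum>i\<in>S. f i * cnj (g i))"
  by (simp_all add: l2_space_def)

lemma hnorm_l2: "hnorm (l2_space S) f = sqrt (\<Sum>i\<in>S. (cmod (f i))\<^sup>2)"
  by (simp add: hnorm_def complex_mult_cnj cmod_power2)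

lemma abelian_group_l2: "abelian_group (l2_space S)"
proof (rule abelian_groupI)
  fix f assume "f \<in> carrier (l2_space S)"
  then have "(\<lambda>i. - f i) \<in> carrier (l2_space S)"
    "(\<lambda>i. - f i) \<oplus>\<^bsub>l2_space S\<^esub> f = \<zero>\<^bsub>l2_space S\<^esub>"
    by auto
  then show "\<exists>g\<in>carrier (l2_space S). g \<oplus>\<^bsub>l2_space S\<^esub> f = \<zero>\<^bsub>l2_space S\<^esub>"
    by blast
qed (auto simp: add.assoc add.commute)

lemma l2_minus [simp]:
  assumes "f \<in> carrier (l2_space S)" "g \<in> carrier (l2_space S)"
  shows "f \<ominus>\<^bsub>l2_space S\<^esub> g = (\<lambda>i. f i - g i)"
proof -
  interpret abelian_group "l2_space S" by (rule abelian_group_l2)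
  have "\<ominus>\<^bsub>l2_space S\<^esub> g = (\<lambda>i. - g i)"
    by (rule minus_equality) (use assms in auto)
  then show ?thesis
    by (simp add: a_minus_def)
qed

lemma l2_finsum:
  assumes "finite F" "\<And>i. i \<in> F \<Longrightarrow> g i \<in> carrier (l2_space S)"
  shows "(\<Oplus>\<^bsub>l2_space S\<^esub>i\<in>F. g i) = (\<lambda>j. \<Sum>i\<in>F. g i j)"
proof -
  interpret abelian_group "l2_space S" by (rule abelian_group_l2)
  show ?thesis
    using assms
  proof (induction F rule: finite_induct)
    case (insert x F)
    then have "(\<Oplus>\<^bsub>l2_space S\<^esub>i\<in>insert x F. g i) = g x \<oplus>\<^bsub>l2_space S\<^esub> (\<Oplus>\<^bsub>l2_space S\<^esub>i\<in>F. g i)"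
      by (intro finsum_insert) auto
    with insert show ?case by simp
  qed simp
qed

lemma cring_complex_field: "cring complex_field"
proof (rule cringI)
  show "abelian_group complex_field"
    by (rule abelian_groupI)
      (auto simp: complex_field_def add.assoc add.commute intro: exI[of _ "- x" for x])
  show "Group.comm_monoid complex_field"
    by (rule comm_monoidI) (auto simp: complex_field_def)
qed (auto simp: complex_field_def algebra_simps)

lemma cmod_le_hnorm_l2:
  assumes "finite S" "i \<in> S"
  shows "cmod (f i) \<le> hnorm (l2_space S) f"
  unfolding hnorm_l2
  by (rule real_le_rsqrt) (use assms in \<open>auto intro: member_le_sum[where f = "\<lambda>i. (cmod (f i))\<^sup>2"]\<close>)

lemma hilbert_space_l2:
  assumes "finite S"
  shows "hilbert_space (l2_space S)"
proof (intro hilbert_space.intro hilbert_space_axioms.intro)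
  show "Module.module complex_field (l2_space S)"
    by (rule moduleI[OF cring_complex_field abelian_group_l2])
      (auto simp: complex_field_def algebra_simps)
next
  fix f assume "f \<in> carrier (l2_space S)" "cinner (l2_space S) f f = 0"
  then have "(\<Sum>i\<in>S. (cmod (f i))\<^sup>2) = 0"
    by (simp add: complex_mult_cnj flip: cmod_power2 of_real_power of_real_sum)
  then have "\<forall>i\<in>S. f i = 0"
    using assms by (simp add: sum_nonneg_eq_0_iff)
  then show "f = \<zero>\<^bsub>l2_space S\<^esub>"
    using \<open>f \<in> _\<close> by auto
next
  fix s :: "nat \<Rightarrow> 'a \<Rightarrow> complex"
  assume s: "\<And>n. s n \<in> carrier (l2_space S)"
    and Cauchy: "\<And>\<epsilon>. \<epsilon> > 0 \<Longrightarrow> \<exists>N. \<forall>m\<ge>N. \<forall>n\<ge>N. hnorm (l2_space S) (s m \<ominus>\<^bsub>l2_space S\<^esub> s n) < \<epsilon>"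
  \<comment> \<open>Completeness is checked coordinatewise: a coordinate in \<open>S\<close> is
    dominated by the norm, and any other coordinate is constantly 0.\<close>
  have "convergent (\<lambda>n. s n i)" for i
  proof (cases "i \<in> S")
    case True
    have "Cauchy (\<lambda>n. s n i)"
      unfolding Cauchy_def dist_norm
    proof (intro allI impI)
      fix \<epsilon> :: real assume "\<epsilon> > 0"
      then obtain N where N: "\<forall>m\<ge>N. \<forall>n\<ge>N. hnorm (l2_space S) (s m \<ominus>\<^bsub>l2_space S\<^esub> s n) < \<epsilon>"
        using Cauchy by blast
      have "cmod (s m i - s n i) < \<epsilon>" if "m \<ge> N" "n \<ge> N" for m n
        using cmod_le_hnorm_l2[OF assms True, of "\<lambda>i. s m i - s n i"] N that
        unfolding l2_minus[OF s s] by (meson le_less_trans)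
      then show "\<exists>N. \<forall>m\<ge>N. \<forall>n\<ge>N. cmod (s m i - s n i) < \<epsilon>"
        by blast
    qed
    then show ?thesis by (simp add: Cauchy_convergent)
  next
    case False
    then show ?thesis using s by (simp add: convergent_const)
  qed
  then obtain f where f: "(\<lambda>n. s n i) \<longlonglongrightarrow> f i" for i
    unfolding convergent_def by metis
  have "f i = 0" if "i \<notin> S" for i
    using f[of i] s that by (simp add: LIMSEQ_const_iff)
  then have "f \<in> carrier (l2_space S)" by simp
  \<comment> \<open>The limit is 0, left in the form that the limit rules produce.\<close>
  moreover have "(\<lambda>n. hnorm (l2_space S) (\<lambda>i. s n i - f i)) \<longlonglongrightarrow> sqrt (\<Sum>i\<in>S. (cmod (f i - f i))\<^sup>2)"
    unfolding hnorm_l2 by (intro tendsto_intros f)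
  ultimately show "\<exists>f\<in>carrier (l2_space S). (\<lambda>n. hnorm (l2_space S) (s n \<ominus>\<^bsub>l2_space S\<^esub> f)) \<longlonglongrightarrow> 0"
    using s by (intro bexI[of _ f]) simp_all
next
  fix f assume "f \<in> carrier (l2_space S)"
  show "0 \<le> Re (cinner (l2_space S) f f)"
    by (auto simp: complex_mult_cnj intro!: sum_nonneg)
qed (auto simp: sum.distrib sum_distrib_left algebra_simps)


section \<open>Criteria for projections and for strong sums\<close>

text \<open>Boundedness comes for free with constant 1: a self-adjoint idempotent satisfies
  Pythagoras, so the squared norm of \<open>f - P f\<close> is that of \<open>f\<close> minus that
  of \<open>P f\<close>.\<close>

lemma projection_l2I:
  assumes "finite S"
    and closed: "\<And>f. f \<in> carrier (l2_space S) \<Longrightarrow> P f \<in> carrier (l2_space S)"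
    and add: "\<And>f g. P (\<lambda>i. f i + g i) = (\<lambda>i. P f i + P g i)"
    and scale: "\<And>c f. P (\<lambda>i. c * f i) = (\<lambda>i. c * P f i)"
    and idem: "\<And>f. P (P f) = P f"
    and adj: "\<And>f g. (\<Sum>i\<in>S. P f i * cnj (g i)) = (\<Sum>i\<in>S. f i * cnj (P g i))"
  shows "projection (l2_space S) P"
proof -
  have "hnorm (l2_space S) (P f) \<le> 1 * hnorm (l2_space S) f" for f
  proof -
    have "(\<Sum>i\<in>S. (f i - P f i) * cnj (f i - P f i)) =
        (\<Sum>i\<in>S. f i * cnj (f i)) - (\<Sum>i\<in>S. f i * cnj (P f i)) -
        ((\<Sum>i\<in>S. P f i * cnj (f i)) - (\<Sum>i\<in>S. P f i * cnj (P f i)))"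
      by (simp add: algebra_simps sum.distrib sum_subtractf)
    \<comment> \<open>The inner products of \<open>P f\<close> with \<open>f\<close>, of
      \<open>f\<close> with \<open>P f\<close> and of \<open>P f\<close> with itself all
      coincide.\<close>
    also have "\<dots> = (\<Sum>i\<in>S. f i * cnj (f i)) - (\<Sum>i\<in>S. P f i * cnj (P f i))"
      using adj[of f f] adj[of f "P f"] by (simp add: idem)
    finally have "Re (\<Sum>i\<in>S. (f i - P f i) * cnj (f i - P f i)) =
        Re (\<Sum>i\<in>S. f i * cnj (f i)) - Re (\<Sum>i\<in>S. P f i * cnj (P f i))"
      by simp
    moreover have "0 \<le> Re (\<Sum>i\<in>S. (f i - P f i) * cnj (f i - P f i))"
      unfolding Re_sum complex_mult_cnj by (rule sum_nonneg) simp
    ultimately show ?thesis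
      by (simp add: hnorm_def)
  qed
  then have "\<exists>C. \<forall>f\<in>carrier (l2_space S). hnorm (l2_space S) (P f) \<le> C * hnorm (l2_space S) f"
    by blast
  then show ?thesis
    using closed by (auto simp: projection_def bounded_op_def add scale idem adj)
qed

text \<open>\<open>V\<close> may be infinite, but each row and column constructed below has only
  finitely many nonzero entries. Collecting their indices in \<open>F0\<close> makes the net of
  partial sums eventually constant, so no limit has to be estimated.\<close>

lemma sot_sums_to_one_l2I:
  assumes closed: "\<And>i f. i \<in> I \<Longrightarrow> f \<in> carrier (l2_space S) \<Longrightarrow> T i f \<in> carrier (l2_space S)"
    and F0: "finite F0" "F0 \<subseteq> I"
    and sum: "\<And>f F j. f \<in> carrier (l2_space S) \<Longrightarrow> finite F \<Longrightarrow> F0 \<subseteq> F \<Longrightarrow> F \<subseteq> I \<Longrightarrow>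
      (\<Sum>i\<in>F. T i f j) = f j"
  shows "sot_sums_to_one (l2_space S) T I"
  unfolding sot_sums_to_one_def
proof
  fix f assume f: "f \<in> carrier (l2_space S)"
  have "hnorm (l2_space S) ((\<Oplus>\<^bsub>l2_space S\<^esub>i\<in>F. T i f) \<ominus>\<^bsub>l2_space S\<^esub> f) = 0"
    if F: "finite F" "F0 \<subseteq> F" "F \<subseteq> I" for F
  proof -
    have "(\<Oplus>\<^bsub>l2_space S\<^esub>i\<in>F. T i f) = (\<lambda>j. \<Sum>i\<in>F. T i f j)"
      by (rule l2_finsum) (use F f closed in blast)+
    also have "\<dots> = f"
      using sum[OF f F] by blast
    finally show ?thesis
      using f by (simp add: hnorm_def)
  qed
  then have "\<forall>\<^sub>F F in finite_subsets_at_top I.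
      hnorm (l2_space S) ((\<Oplus>\<^bsub>l2_space S\<^esub>i\<in>F. T i f) \<ominus>\<^bsub>l2_space S\<^esub> f) = 0"
    unfolding eventually_finite_subsets_at_top using F0 by blast
  then show "((\<lambda>F. hnorm (l2_space S) ((\<Oplus>\<^bsub>l2_space S\<^esub>i\<in>F. T i f) \<ominus>\<^bsub>l2_space S\<^esub> f)) \<longlongrightarrow> 0)
      (finite_subsets_at_top I)"
    by (rule tendsto_eventually)
qed

section \<open>Standard basis and dimension\<close>

definition unit_fun :: "'i \<Rightarrow> 'i \<Rightarrow> complex" where
  "unit_fun i = (\<lambda>j. if j = i then 1 else 0)"

lemma unit_fun_simps [simp]: "unit_fun i i = 1" "j \<noteq> i \<Longrightarrow> unit_fun i j = 0"
  by (simp_all add: unit_fun_def)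

lemma sum_unit_fun:
  assumes "finite S"
  shows "(\<Sum>l\<in>S. unit_fun i l * g l) = (if i \<in> S then g i else 0)"
    and "(\<Sum>l\<in>S. g l * cnj (unit_fun i l)) = (if i \<in> S then g i else 0)"
    and "(\<Sum>l\<in>S. g l * unit_fun l i) = (if i \<in> S then g i else 0)"
proof -
  have *: "unit_fun i l * g l = (if i = l then g l else 0)"
    "g l * cnj (unit_fun i l) = (if i = l then g l else 0)"
    "g l * unit_fun l i = (if i = l then g l else 0)" for l
    by (auto simp: unit_fun_def)
  show "(\<Sum>l\<in>S. unit_fun i l * g l) = (if i \<in> S then g i else 0)"
    "(\<Sum>l\<in>S. g l * cnj (unit_fun i l)) = (if i \<in> S then g i else 0)"
    "(\<Sum>l\<in>S. g l * unit_fun l i) = (if i \<in> S then g i else 0)"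
    unfolding * using assms by (simp_all add: sum.delta)
qed

lemma inj_unit_fun: "inj unit_fun"
  unfolding unit_fun_def inj_def by (metis zero_neq_one)

lemma has_dimension_l2:
  assumes "finite S"
  shows "has_dimension (l2_space S) (card S)"
  unfolding has_dimension_def
proof (intro exI conjI)
  have "f = (\<lambda>_. 0)"
    if "f \<in> carrier (l2_space S)" "\<forall>i\<in>S. cinner (l2_space S) f (unit_fun i) = 0" for f
  proof
    fix i
    show "f i = 0"
      using that assms by (cases "i \<in> S") (auto simp: sum_unit_fun)
  qed
  then show "orthonormal_basis (l2_space S) (unit_fun ` S)"
    using assms by (auto simp: orthonormal_basis_def sum_unit_fun, auto simp: unit_fun_def)
  show "card (unit_fun ` S) = card S"
    by (rule card_image) (rule inj_on_subset[OF inj_unit_fun subset_UNIV])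
qed (use assms in simp)

text \<open>\<open>has_dimension\<close> only asserts that some basis of the given size exists, so
  dimension 1 must be excluded separately: with two coordinates, no single vector \<open>b\<close>
  has trivial orthogonal complement.\<close>

lemma has_dimension_l2_1_imp_eq:
  assumes "finite S" "has_dimension (l2_space S) 1" "i \<in> S" "j \<in> S"
  shows "i = j"
proof (rule ccontr)
  assume "i \<noteq> j"
  obtain b where "orthonormal_basis (l2_space S) {b}"
    using assms(2) unfolding has_dimension_def by (metis card_1_singletonE)
  then have ort: "f = (\<lambda>_. 0)"
    if "f \<in> carrier (l2_space S)" "cinner (l2_space S) f b = 0" for f
    using that unfolding orthonormal_basis_def by auto
  \<comment> \<open>The two terms have the same inner product with \<open>b\<close>, so
    \<open>?f\<close> is orthogonal to \<open>b\<close>.\<close>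
  let ?f = "\<lambda>l. cnj (b j) * unit_fun i l - cnj (b i) * unit_fun j l"
  have "cinner (l2_space S) ?f b =
      cnj (b j) * (\<Sum>l\<in>S. unit_fun i l * cnj (b l)) - cnj (b i) * (\<Sum>l\<in>S. unit_fun j l * cnj (b l))"
    by (simp add: left_diff_distrib sum_subtractf sum_distrib_left mult.assoc)
  also have "\<dots> = 0"
    using assms by (simp add: sum_unit_fun)
  finally have "?f = (\<lambda>_. 0)"
    using assms by (intro ort) (auto simp: unit_fun_def)
  from fun_cong[OF this, of i] have "b j = 0"
    using \<open>i \<noteq> j\<close> by (simp add: unit_fun_def)
  then have "unit_fun j = (\<lambda>_. 0)"
    using assms by (intro ort) (auto simp: sum_unit_fun, auto simp: unit_fun_def)
  from fun_cong[OF this, of j] show False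
    by (simp add: unit_fun_def)
qed

lemma bounded_op_l2_expand:
  assumes "finite S" "bounded_op (l2_space S) T" "f \<in> carrier (l2_space S)"
  shows "T f = (\<lambda>j. \<Sum>i\<in>S. f i * T (unit_fun i) j)"
proof -
  have add: "T (\<lambda>i. f i + g i) = (\<lambda>i. T f i + T g i)"
    if "f \<in> carrier (l2_space S)" "g \<in> carrier (l2_space S)" for f g
    using assms(2) that unfolding bounded_op_def by auto
  have scale: "T (\<lambda>i. c * f i) = (\<lambda>i. c * T f i)" if "f \<in> carrier (l2_space S)" for c f
    using assms(2) that unfolding bounded_op_def by auto
  have "T (\<lambda>j. \<Sum>i\<in>A. f i * unit_fun i j) = (\<lambda>j. \<Sum>i\<in>A. f i * T (unit_fun i) j)"
    if "finite A" "A \<subseteq> S" for A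
    using that
  proof (induction A rule: finite_induct)
    case empty
    \<comment> \<open>Homogeneity with the scalar 0 gives that \<open>T\<close> sends 0 to
      0.\<close>
    then show ?case using scale[of "\<lambda>_. 0" 0] by simp
  next
    case (insert a A)
    have "T (\<lambda>j. f a * unit_fun a j + (\<Sum>i\<in>A. f i * unit_fun i j)) =
        (\<lambda>j. T (\<lambda>j. f a * unit_fun a j) j + T (\<lambda>j. \<Sum>i\<in>A. f i * unit_fun i j) j)"
      using insert by (intro add) (auto simp: unit_fun_def intro!: sum.neutral)
    moreover have "T (\<lambda>j. f a * unit_fun a j) = (\<lambda>j. f a * T (unit_fun a) j)"
      using insert by (intro scale) (auto simp: unit_fun_def)
    ultimately show ?case
      using insert by simp
  qed
  moreover have "(\<lambda>j. \<Sum>i\<in>S. f i * unit_fun i j) = f"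
    using assms(1,3) by (auto simp: sum_unit_fun)
  ultimately show ?thesis
    using assms(1) by fastforce
qed

section \<open>The averaging projection\<close>

text \<open>For finite nonempty \<open>S\<close> this is the orthogonal projection onto the line
  spanned by the all-ones vector on \<open>S\<close>, that is, the projection
  \<open>q\<close>.\<close>

definition mean :: "'i set \<Rightarrow> ('i \<Rightarrow> complex) \<Rightarrow> 'i \<Rightarrow> complex" where
  "mean S f i = (if i \<in> S then (\<Sum>j\<in>S. f j) / of_nat (card S) else 0)"

lemma mean_add: "mean S (\<lambda>i. f i + g i) = (\<lambda>i. mean S f i + mean S g i)"
  by (auto simp: mean_def sum.distrib add_divide_distrib)

lemma mean_diff: "mean S (\<lambda>i. f i - g i) = (\<lambda>i. mean S f i - mean S g i)"
  by (auto simp: mean_def sum_subtractf diff_divide_distrib)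

lemma mean_scale: "mean S (\<lambda>i. c * f i) = (\<lambda>i. c * mean S f i)"
  by (auto simp: mean_def sum_distrib_left)

lemma mean_zero: "mean S (\<lambda>_. 0) = (\<lambda>_. 0)"
  by (auto simp: mean_def)

lemma mean_mean: "finite S \<Longrightarrow> mean S (mean S f) = mean S f"
  by (auto simp: mean_def fun_eq_iff)

lemma mean_adj: "(\<Sum>i\<in>S. mean S f i * cnj (g i)) = (\<Sum>i\<in>S. f i * cnj (mean S g i))"
  by (simp add: mean_def algebra_simps flip: sum_distrib_left sum_distrib_right sum_divide_distrib)


section \<open>The quantum automorphism of a disjoint pair\<close>

locale disjoint_aut_pair =
  fixes V :: "'v set" and E :: "('v \<times> 'v) set" and \<sigma> \<tau> :: "'v \<Rightarrow> 'v"
  assumes graph: "simple_graph V E"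
    and \<sigma>: "\<sigma> \<in> carrier (aut_group V E)"
    and \<tau>: "\<tau> \<in> carrier (aut_group V E)"
    and disjoint: "disjoint_auts V \<sigma> \<tau>"
begin

lemma \<sigma>_eq_iff: "x \<in> V \<Longrightarrow> y \<in> V \<Longrightarrow> (\<sigma> ^^ n) x = (\<sigma> ^^ n) y \<longleftrightarrow> x = y"
  using bij_betw_funpow_aut[OF \<sigma>, of n] by (auto simp: bij_betw_def inj_on_eq_iff)

lemma \<tau>_eq_iff: "x \<in> V \<Longrightarrow> y \<in> V \<Longrightarrow> \<tau> x = \<tau> y \<longleftrightarrow> x = y"
  using bij_betw_funpow_aut[OF \<tau>, of 1] by (auto simp: bij_betw_def inj_on_eq_iff)

lemma \<sigma>_mem: "x \<in> V \<Longrightarrow> (\<sigma> ^^ n) x \<in> V"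
  using funpow_aut[OF \<sigma>] .

lemma \<tau>_mem: "x \<in> V \<Longrightarrow> \<tau> x \<in> V"
  using funpow_aut[OF \<tau>, of x 1] by simp

lemma moved_imp_fixed: "x \<in> V \<Longrightarrow> \<sigma> x \<noteq> x \<Longrightarrow> \<tau> x = x" "x \<in> V \<Longrightarrow> \<tau> x \<noteq> x \<Longrightarrow> \<sigma> x = x"
  using disjoint by (auto simp: disjoint_auts_def)

lemma \<sigma>_fix_funpow: "x \<in> V \<Longrightarrow> \<sigma> ((\<sigma> ^^ n) x) = (\<sigma> ^^ n) x \<longleftrightarrow> \<sigma> x = x"
  using \<sigma>_eq_iff[of "\<sigma> x" x n] \<sigma>_mem[of x 1] by (simp add: funpow_swap1)

text \<open>By injectivity a vertex moved by \<open>\<tau>\<close> is sent to a vertex again moved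
  by \<open>\<tau>\<close>, and \<open>\<sigma>\<close> fixes both. With
  \<open>\<sigma>_fix_funpow\<close>, the vertices moved by \<open>\<sigma>\<close> and those fixed
  by it form two classes that both automorphisms preserve.\<close>

lemma \<sigma>_fix_\<tau>:
  assumes "x \<in> V"
  shows "\<sigma> (\<tau> x) = \<tau> x \<longleftrightarrow> \<sigma> x = x"
proof (cases "\<tau> x = x")
  case False
  then have "\<tau> (\<tau> x) \<noteq> \<tau> x"
    using \<tau>_eq_iff assms \<tau>_mem by blast
  then show ?thesis
    using False moved_imp_fixed(2) assms \<tau>_mem by blast
qed simp

lemma rel_sym: "rel E x y = rel E y x"
  using graph by (auto simp: rel_def simple_graph_def dest: symD)

lemma rel_\<sigma>: "x \<in> V \<Longrightarrow> y \<in> V \<Longrightarrow> rel E ((\<sigma> ^^ n) x) ((\<sigma> ^^ n) y) = rel E x y"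
  by (simp add: rel_def \<sigma>_eq_iff funpow_aut_edge[OF \<sigma>])

lemma rel_\<tau>: "x \<in> V \<Longrightarrow> y \<in> V \<Longrightarrow> rel E (\<tau> x) (\<tau> y) = rel E x y"
  using funpow_aut_edge[OF \<tau>, of x y 1] by (simp add: rel_def \<tau>_eq_iff)

text \<open>This is where disjointness yields compatibility with adjacency. Applying
  \<open>\<sigma> ^^ n\<close> to the pair moves only \<open>x\<close>, and applying
  \<open>\<tau>\<close> afterwards moves only \<open>y\<close>, so the two choices can be made
  independently.\<close>

lemma rel_\<sigma>_\<tau>:
  assumes "x \<in> V" "y \<in> V" "\<sigma> x \<noteq> x" "\<sigma> y = y" "z = y \<or> z = \<tau> y"
  shows "rel E ((\<sigma> ^^ n) x) z = rel E x y"
proof -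
  have "(\<sigma> ^^ n) y = y"
    using assms(4) by (induction n) auto
  then have *: "rel E ((\<sigma> ^^ n) x) y = rel E x y"
    using rel_\<sigma>[OF assms(1,2), of n] by simp
  have "\<tau> ((\<sigma> ^^ n) x) = (\<sigma> ^^ n) x"
    using moved_imp_fixed(1) \<sigma>_mem \<sigma>_fix_funpow assms(1,3) by blast
  then have "rel E ((\<sigma> ^^ n) x) (\<tau> y) = rel E ((\<sigma> ^^ n) x) y"
    using rel_\<tau>[OF \<sigma>_mem[OF assms(1)] assms(2), of n] by simp
  with * assms(5) show ?thesis by auto
qed

section \<open>The matrix of projections\<close>

text \<open>The second component of an index is the exponent \<open>n\<close> of the axis projection
  \<open>p_n\<close>; the first only makes the index type fit. In the moved case the entry is the
  sum of the \<open>p_n\<close> with \<open>(\<sigma> ^^ n) x = y\<close>. In the fixed case the two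
  summands carry \<open>q\<close> and \<open>1 - q\<close>, and they add up to the identity if
  \<open>\<tau> x = x\<close>.\<close>

definition u :: "('i \<times> nat) set \<Rightarrow> 'v \<Rightarrow> 'v \<Rightarrow> ('i \<times> nat \<Rightarrow> complex) \<Rightarrow> 'i \<times> nat \<Rightarrow> complex" where
  "u S x y f = (if \<sigma> x \<noteq> x then (\<lambda>i. if (\<sigma> ^^ snd i) x = y then f i else 0)
     else (\<lambda>i. (if y = x then mean S f i else 0) + (if y = \<tau> x then f i - mean S f i else 0)))"

lemma u_moved: "\<sigma> x \<noteq> x \<Longrightarrow> u S x y f = (\<lambda>i. if (\<sigma> ^^ snd i) x = y then f i else 0)"
  and u_fixed: "\<sigma> x = x \<Longrightarrow> u S x y f =
     (\<lambda>i. (if y = x then mean S f i else 0) + (if y = \<tau> x then f i - mean S f i else 0))"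
  by (simp_all add: u_def)

lemma u_closed: "f \<in> carrier (l2_space S) \<Longrightarrow> u S x y f \<in> carrier (l2_space S)"
  by (simp add: u_def mean_def)

lemma u_zero: "u S x y (\<lambda>_. 0) = (\<lambda>_. 0)"
  by (auto simp: u_def mean_zero fun_eq_iff)

lemma projection_u:
  assumes "finite S"
  shows "projection (l2_space S) (u S x y)"
proof (rule projection_l2I[OF assms u_closed])
  fix f g :: "'a \<times> nat \<Rightarrow> complex" and c
  show "u S x y (\<lambda>i. f i + g i) = (\<lambda>i. u S x y f i + u S x y g i)"
    by (auto simp: u_def mean_add fun_eq_iff)
  show "u S x y (\<lambda>i. c * f i) = (\<lambda>i. c * u S x y f i)"
    by (auto simp: u_def mean_scale fun_eq_iff algebra_simps)
  show "u S x y (u S x y f) = u S x y f"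
    by (auto simp: u_def mean_diff mean_mean[OF assms] mean_zero fun_eq_iff)
  show "(\<Sum>i\<in>S. u S x y f i * cnj (g i)) = (\<Sum>i\<in>S. f i * cnj (u S x y g i))"
  proof (cases "\<sigma> x = x")
    case False
    then show ?thesis
      by (auto simp: u_def intro!: sum.cong)
  next
    case True
    then show ?thesis
      using mean_adj[of S f g] by (cases "y = x"; cases "y = \<tau> x")
        (simp_all add: u_def left_diff_distrib right_diff_distrib sum_subtractf)
  qed
qed

lemma u_row_sum:
  assumes "finite S" "x \<in> V"
  shows "sot_sums_to_one (l2_space S) (\<lambda>y. u S x y) V"
proof (cases "\<sigma> x = x")
  case False
  show ?thesis
  proof (rule sot_sums_to_one_l2I[where ?F0.0 = "(\<lambda>i. (\<sigma> ^^ snd i) x) ` S", OF u_closed])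
    fix f F j
    assume f: "f \<in> carrier (l2_space S)" and F: "finite F" "(\<lambda>i. (\<sigma> ^^ snd i) x) ` S \<subseteq> F"
    show "(\<Sum>y\<in>F. u S x y f j) = f j"
    proof (cases "j \<in> S")
      case True
      then show ?thesis
        using F False by (auto simp: u_moved image_subset_iff)
    next
      case j: False
      \<comment> \<open>For such \<open>j\<close> the vertex \<open>(\<sigma> ^^ snd j) x\<close>
        may lie outside \<open>F\<close>, but then every summand is 0 anyway.\<close>
      then have "f j = 0"
        using f unfolding l2_simps by blast
      then show ?thesis
        using False by (simp add: u_moved cong: if_cong)
    qed
  qed (use assms \<sigma>_mem in auto)
next
  case True
  show ?thesis
  proof (rule sot_sums_to_one_l2I[where ?F0.0 = "{x, \<tau> x}", OF u_closed])
    fix f F j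
    assume f: "f \<in> carrier (l2_space S)" and F: "finite F" "{x, \<tau> x} \<subseteq> F"
    show "(\<Sum>y\<in>F. u S x y f j) = f j"
      using F by (simp add: u_fixed True sum.distrib)
  qed (use assms \<tau>_mem in auto)
qed

text \<open>Entries with \<open>x\<close> and \<open>y\<close> in different classes vanish, since
  both automorphisms preserve the classes. Within a class, the nonzero entries sit at preimages of
  \<open>y\<close>, which are unique by injectivity.\<close>

lemma u_column_sum:
  assumes "finite S" "y \<in> V"
  shows "sot_sums_to_one (l2_space S) (\<lambda>x. u S x y) V"
proof (cases "\<sigma> y = y")
  case False
  define z where "z n = inv_into V (\<sigma> ^^ n) y" for n
  have z: "z n \<in> V" "(\<sigma> ^^ n) (z n) = y" for n
    using bij_betw_funpow_aut[OF \<sigma>, of n] assms(2) unfolding z_def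
    by (auto simp: bij_betw_def inv_into_into f_inv_into_f)
  have u: "u S x y f j = (if x = z (snd j) then f j else 0)" if "x \<in> V" for x f j
  proof (cases "\<sigma> x = x")
    case True
    then have "y \<noteq> x" "y \<noteq> \<tau> x" "x \<noteq> z (snd j)"
      using False \<sigma>_fix_\<tau> that z \<sigma>_fix_funpow by metis+
    then show ?thesis using True by (simp add: u_fixed)
  next
    case False
    then show ?thesis
      using \<sigma>_eq_iff[OF that z(1), of "snd j" "snd j"] by (simp add: u_moved z(2))
  qed
  show ?thesis
  proof (rule sot_sums_to_one_l2I[where ?F0.0 = "(\<lambda>i. z (snd i)) ` S", OF u_closed])
    fix f F j
    assume f: "f \<in> carrier (l2_space S)" and F: "finite F" "(\<lambda>i. z (snd i)) ` S \<subseteq> F" "F \<subseteq> V"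
    have "(\<Sum>x\<in>F. u S x y f j) = (\<Sum>x\<in>F. if x = z (snd j) then f j else 0)"
      using F by (intro sum.cong) (auto simp: u)
    also have "\<dots> = f j"
    proof (cases "j \<in> S")
      case True
      then show ?thesis
        using F by (auto simp: image_subset_iff)
    next
      case False
      then have "f j = 0"
        using f unfolding l2_simps by blast
      then show ?thesis by (simp cong: if_cong)
    qed
    finally show "(\<Sum>x\<in>F. u S x y f j) = f j" .
  qed (use assms z in auto)
next
  case True
  have "y \<in> \<tau> ` V"
    using bij_betw_imp_surj_on[OF bij_betw_funpow_aut[OF \<tau>, of 1]] assms(2) by simp
  then obtain z where z: "z \<in> V" "\<tau> z = y"
    by (elim imageE) simp
  have u: "u S x y f j = (if x = y then mean S f j else 0) + (if x = z then f j - mean S f j else 0)"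
    if "x \<in> V" for x f j
  proof (cases "\<sigma> x = x")
    case False
    then have "(\<sigma> ^^ snd j) x \<noteq> y" "x \<noteq> y" "x \<noteq> z"
      using True \<sigma>_fix_\<tau> that z \<sigma>_fix_funpow by metis+
    then show ?thesis using False by (simp add: u_moved)
  next
    case True
    have "y = \<tau> x \<longleftrightarrow> x = z" "y = x \<longleftrightarrow> x = y"
      using \<tau>_eq_iff[OF that z(1)] z(2) by metis+
    then show ?thesis
      unfolding u_fixed[OF True] by presburger
  qed
  show ?thesis
  proof (rule sot_sums_to_one_l2I[where ?F0.0 = "{y, z}", OF u_closed])
    fix f F j
    assume F: "finite F" "{y, z} \<subseteq> F" "F \<subseteq> V"
    have "(\<Sum>x\<in>F. u S x y f j) =
        (\<Sum>x\<in>F. (if x = y then mean S f j else 0) + (if x = z then f j - mean S f j else 0))"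
      using F by (intro sum.cong) (auto simp: u)
    also have "\<dots> = f j"
      using F by (simp add: sum.distrib)
    finally show "(\<Sum>x\<in>F. u S x y f j) = f j" .
  qed (use assms z in auto)
qed

text \<open>If both \<open>x1\<close> and \<open>x2\<close> are moved, orthogonality of the
  \<open>p_n\<close> forces the same power of \<open>\<sigma>\<close> on both. If both are fixed,
  \<open>q (1 - q) = 0\<close> leaves only the pairs \<open>(x1, x2)\<close> and
  \<open>(\<tau> x1, \<tau> x2)\<close>. In the mixed cases the projections need not commute, but
  every combination of images preserves the relation by \<open>rel_\<sigma>_\<tau>\<close>.\<close>

lemma u_mult_eq_0:
  assumes "finite S" "x1 \<in> V" "x2 \<in> V" "y1 \<in> V" "y2 \<in> V" and ne: "rel E x1 x2 \<noteq> rel E y1 y2"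
  shows "u S x1 y1 (u S x2 y2 f) = (\<lambda>_. 0)"
proof -
  consider "\<sigma> x1 \<noteq> x1" "\<sigma> x2 \<noteq> x2" | "\<sigma> x1 \<noteq> x1" "\<sigma> x2 = x2"
    | "\<sigma> x1 = x1" "\<sigma> x2 \<noteq> x2" | "\<sigma> x1 = x1" "\<sigma> x2 = x2"
    by blast
  then show ?thesis
  proof cases
    case 1
    then show ?thesis
      using rel_\<sigma>[OF assms(2,3)] ne by (auto simp: u_moved fun_eq_iff)
  next
    case 2
    show ?thesis
    proof (cases "y2 = x2 \<or> y2 = \<tau> x2")
      case True
      then have "(\<sigma> ^^ n) x1 \<noteq> y1" for n
        using rel_\<sigma>_\<tau>[OF assms(2,3) 2] ne by metis
      then show ?thesis using 2 by (simp add: u_moved)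
    next
      case False
      then show ?thesis using 2 by (simp add: u_fixed u_zero)
    qed
  next
    case 3
    show ?thesis
    proof (cases "y1 = x1 \<or> y1 = \<tau> x1")
      case True
      then have "(\<sigma> ^^ n) x2 \<noteq> y2" for n
        using rel_\<sigma>_\<tau>[OF assms(3,2) 3(2,1)] ne rel_sym by metis
      then show ?thesis using 3(2) by (simp add: u_moved u_zero)
    next
      case False
      then show ?thesis using 3 by (simp add: u_fixed)
    qed
  next
    case 4
    have "\<not> (y1 = x1 \<and> y2 = x2)" "\<not> (y1 = \<tau> x1 \<and> y2 = \<tau> x2)"
      using ne rel_\<tau>[OF assms(2,3)] by auto
    then show ?thesis
      using 4 by (cases "y1 = x1"; cases "y1 = \<tau> x1"; cases "y2 = x2"; cases "y2 = \<tau> x2")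
        (simp_all add: u_fixed mean_diff mean_mean[OF assms(1)] mean_zero)
  qed
qed

lemma quantum_automorphism_u:
  assumes "finite S"
  shows "quantum_automorphism V E (l2_space S) (u S)"
  unfolding quantum_automorphism_def pairwise_orthogonal_def
proof (intro conjI ballI impI)
  fix x y y' f
  assume "x \<in> V" "y \<in> V" "y' \<in> V" "y \<noteq> y'"
  \<comment> \<open>Orthogonality in rows and columns is the case of \<open>u_mult_eq_0\<close> in
    which exactly one of the two vertex pairs has relation \<open>Equal\<close>.\<close>
  then show "u S x y (u S x y' f) = \<zero>\<^bsub>l2_space S\<^esub>" "u S y x (u S y' x f) = \<zero>\<^bsub>l2_space S\<^esub>"
    using u_mult_eq_0[OF assms, of x x y y'] u_mult_eq_0[OF assms, of y y' x x]
    by (auto simp: rel_def)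
qed (use assms in \<open>auto simp: hilbert_space_l2 projection_u u_row_sum u_column_sum u_mult_eq_0\<close>)

section \<open>Irreducibility\<close>

lemma scalar_commutant:
  assumes "finite S"
    and separating: "\<And>i j. i \<in> S \<Longrightarrow> j \<in> S \<Longrightarrow> i \<noteq> j \<Longrightarrow> \<exists>x\<in>V. (\<sigma> ^^ snd i) x \<noteq> (\<sigma> ^^ snd j) x"
    and \<tau>_moves: "card S \<le> 1 \<or> (\<exists>x\<in>V. \<tau> x \<noteq> x)"
    and T: "bounded_op (l2_space S) T"
    and comm: "\<And>x y f. x \<in> V \<Longrightarrow> y \<in> V \<Longrightarrow> f \<in> carrier (l2_space S) \<Longrightarrow> T (u S x y f) = u S x y (T f)"
  shows "\<exists>c. \<forall>f\<in>carrier (l2_space S). T f = c \<odot>\<^bsub>l2_space S\<^esub> f"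
proof -
  have T_closed: "T f \<in> carrier (l2_space S)" if "f \<in> carrier (l2_space S)" for f
    using T that unfolding bounded_op_def by blast
  have unit_mem: "unit_fun i \<in> carrier (l2_space S)" if "i \<in> S" for i
    using that by (auto simp: unit_fun_def)
  have off_diag: "T (unit_fun i) j = 0" if ij: "i \<in> S" "j \<noteq> i" for i j
  proof (cases "j \<in> S")
    case True
    then obtain x where x: "x \<in> V" "(\<sigma> ^^ snd i) x \<noteq> (\<sigma> ^^ snd j) x"
      using separating[OF ij(1) True] ij(2) by blast
    \<comment> \<open>A vertex fixed by \<open>\<sigma>\<close> is fixed by all its powers and
      cannot separate two of them.\<close>
    have moved: "\<sigma> x \<noteq> x"
    proof
      assume "\<sigma> x = x"
      then have "(\<sigma> ^^ n) x = x" for n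
        by (induction n) auto
      with x show False by simp
    qed
    \<comment> \<open>This entry fixes the basis vector at \<open>i\<close>, hence also its image
      under \<open>T\<close>, while annihilating coordinate \<open>j\<close>.\<close>
    have "u S x ((\<sigma> ^^ snd i) x) (unit_fun i) = unit_fun i"
      using moved by (auto simp: u_moved unit_fun_def fun_eq_iff)
    then have "T (unit_fun i) = u S x ((\<sigma> ^^ snd i) x) (T (unit_fun i))"
      using comm[OF x(1) \<sigma>_mem[OF x(1)] unit_mem[OF ij(1)]] by metis
    moreover have "u S x ((\<sigma> ^^ snd i) x) (T (unit_fun i)) j = 0"
      using moved x by (simp add: u_moved)
    ultimately show ?thesis by simp
  next
    case False
    then show ?thesis using T_closed[OF unit_mem[OF ij(1)]] unfolding l2_simps by blast
  qed
  have diag: "T f j = f j * T (unit_fun j) j" if "f \<in> carrier (l2_space S)" "j \<in> S" for f j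
  proof -
    have "T f j = (\<Sum>i\<in>S. f i * T (unit_fun i) j)"
      using bounded_op_l2_expand[OF assms(1) T that(1)] by simp
    also have "\<dots> = (\<Sum>i\<in>S. if i = j then f j * T (unit_fun j) j else 0)"
      using off_diag by (intro sum.cong) auto
    finally show ?thesis
      using assms(1) that(2) by simp
  qed
  have "\<exists>c. \<forall>j\<in>S. T (unit_fun j) j = c"
    using \<tau>_moves
  proof
    assume "card S \<le> 1"
    then show ?thesis
      using assms(1) by (metis card_le_Suc0_iff_eq One_nat_def)
  next
    assume "\<exists>x\<in>V. \<tau> x \<noteq> x"
    then obtain x where x: "x \<in> V" "\<tau> x \<noteq> x" by blast
    define w :: "'a \<times> nat \<Rightarrow> complex" where "w = (\<lambda>i. if i \<in> S then 1 else 0)"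
    have w: "w \<in> carrier (l2_space S)" by (simp add: w_def)
    have u: "u S x x f = mean S f" for f
      using x moved_imp_fixed(2)[OF x] by (auto simp: u_fixed fun_eq_iff)
    have "mean S w = w"
      using assms(1) by (auto simp: mean_def w_def fun_eq_iff)
    \<comment> \<open>So \<open>T w\<close> is constant on \<open>S\<close>, and by
      \<open>diag\<close> its value at \<open>j\<close> is the diagonal entry of \<open>T\<close> at
      \<open>j\<close>.\<close>
    then have "T w = mean S (T w)"
      using comm[OF x(1) x(1) w] by (simp add: u)
    then have "T (unit_fun j) j = (\<Sum>i\<in>S. T w i) / of_nat (card S)" if "j \<in> S" for j
      using diag[OF w that] that by (metis mean_def mult_1 w_def)
    then show ?thesis by blast
  qed
  then obtain c where "\<And>j. j \<in> S \<Longrightarrow> T (unit_fun j) j = c" by blast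
  then have "T f = (\<lambda>j. c * f j)" if "f \<in> carrier (l2_space S)" for f
    using diag[OF that] T_closed[OF that] that by (intro ext) (metis l2_simps(1) mult.commute mult_zero_right)
  then show ?thesis by auto
qed

text \<open>The bound by the order of \<open>\<sigma>\<close> makes the powers below
  \<open>k\<close> distinct on \<open>V\<close>, and for \<open>k > 1\<close> the bound by the order
  of \<open>\<tau>\<close> makes \<open>\<tau>\<close> nontrivial. \<open>1 \<le> k\<close> makes
  the space nonzero.\<close>

lemma irreducible_u:
  assumes k: "1 \<le> k" "enat k \<le> elem_order (aut_group V E) \<sigma>" "enat k \<le> elem_order (aut_group V E) \<tau>"
  defines "S \<equiv> {undefined} \<times> {..<k}"
  shows "irreducible_quantum_automorphism V E (l2_space S) (u S)"
proof -
  have fin: "finite S" by (simp add: S_def)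
  have less: "\<exists>x\<in>V. (\<sigma> ^^ m) x \<noteq> (\<sigma> ^^ n) x" if mn: "m < n" "n < k" for m n
  proof -
    \<comment> \<open>Two powers agreeing on \<open>V\<close> would make the power with exponent
      \<open>n - m\<close>, which is positive and below the order, trivial on
      \<open>V\<close>.\<close>
    have "enat (n - m) < elem_order (aut_group V E) \<sigma>"
      by (rule less_le_trans[OF _ k(2)]) (use mn in simp)
    then obtain x where x: "x \<in> V" "(\<sigma> ^^ (n - m)) x \<noteq> x"
      using aut_power_moves[OF \<sigma>, of "n - m"] mn by auto
    have "(\<sigma> ^^ n) x = (\<sigma> ^^ m) ((\<sigma> ^^ (n - m)) x)"
      using mn funpow_add[of m "n - m" \<sigma>] by simp
    then show ?thesis
      using x \<sigma>_eq_iff[OF \<sigma>_mem[OF x(1), of "n - m"] x(1), of m]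
      by (intro bexI[of _ x]) auto
  qed
  have "\<exists>x\<in>V. (\<sigma> ^^ snd i) x \<noteq> (\<sigma> ^^ snd j) x" if "i \<in> S" "j \<in> S" "i \<noteq> j" for i j
  proof -
    have "snd i < k" "snd j < k" "snd i \<noteq> snd j"
      using that by (auto simp: S_def)
    then show ?thesis
      using less[of "snd i" "snd j"] less[of "snd j" "snd i"] by (metis nat_neq_iff)
  qed
  moreover have "card S \<le> 1 \<or> (\<exists>x\<in>V. \<tau> x \<noteq> x)"
  proof (cases "k = 1")
    case False
    then have "enat 1 < elem_order (aut_group V E) \<tau>"
      using k by (metis enat_ord_simps(2) le_neq_implies_less order_less_le_trans)
    then show ?thesis
      using aut_power_moves[OF \<tau>, of 1] by simp
  qed (simp add: S_def)
  moreover have "carrier (l2_space S) \<noteq> {\<zero>\<^bsub>l2_space S\<^esub>}"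
  proof -
    have "unit_fun (undefined, 0) \<in> carrier (l2_space S)"
      using k(1) by (auto simp: S_def unit_fun_def)
    moreover have "unit_fun (undefined, 0) \<noteq> \<zero>\<^bsub>l2_space S\<^esub>"
      by (simp add: unit_fun_def fun_eq_iff)
    ultimately show ?thesis by blast
  qed
  ultimately show ?thesis
    unfolding irreducible_quantum_automorphism_def
    using quantum_automorphism_u[OF fin] scalar_commutant[OF fin] by auto
qed

end

text \<open>The condition \<open>1 \<le> k\<close> excludes the zero space, which irreducibility
  forbids.\<close>

theorem proposition7p7:
  fixes V :: "'v set" and E :: "('v \<times> 'v) set"
  assumes "simple_graph V E"
  shows "(\<forall>\<sigma>\<in>carrier (aut_group V E). \<forall>\<tau>\<in>carrier (aut_group V E). \<forall>k::nat.
            disjoint_auts V \<sigma> \<tau> \<and> 1 \<le> k \<and>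
            enat k \<le> min (elem_order (aut_group V E) \<sigma>) (elem_order (aut_group V E) \<tau>)
            \<longrightarrow> admits_irreducible_of_dimension V E k)
       \<and> ((\<exists>\<sigma>\<in>carrier (aut_group V E). \<exists>\<tau>\<in>carrier (aut_group V E).
            \<sigma> \<noteq> \<one>\<^bsub>aut_group V E\<^esub> \<and> \<tau> \<noteq> \<one>\<^bsub>aut_group V E\<^esub> \<and> disjoint_auts V \<sigma> \<tau>)
            \<longrightarrow> has_quantum_symmetry V E)"
proof (intro conjI ballI allI impI)
  fix \<sigma> \<tau> and k :: nat
  assume auts: "\<sigma> \<in> carrier (aut_group V E)" "\<tau> \<in> carrier (aut_group V E)"
    and k: "disjoint_auts V \<sigma> \<tau> \<and> 1 \<le> k \<and>
      enat k \<le> min (elem_order (aut_group V E) \<sigma>) (elem_order (aut_group V E) \<tau>)"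
  interpret disjoint_aut_pair V E \<sigma> \<tau>
    using assms auts k by unfold_locales auto
  let ?S = "{undefined} \<times> {..<k} :: ('v \<times> nat) set"
  have "irreducible_quantum_automorphism V E (l2_space ?S) (u ?S)"
    using k by (intro irreducible_u) auto
  moreover have "has_dimension (l2_space ?S) k"
    using has_dimension_l2[of ?S] by simp
  ultimately show "admits_irreducible_of_dimension V E k"
    unfolding admits_irreducible_of_dimension_def by blast
next
  assume "\<exists>\<sigma>\<in>carrier (aut_group V E). \<exists>\<tau>\<in>carrier (aut_group V E).
    \<sigma> \<noteq> \<one>\<^bsub>aut_group V E\<^esub> \<and> \<tau> \<noteq> \<one>\<^bsub>aut_group V E\<^esub> \<and> disjoint_auts V \<sigma> \<tau>"
  then obtain \<sigma> \<tau> where auts: "\<sigma> \<in> carrier (aut_group V E)" "\<tau> \<in> carrier (aut_group V E)"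
    and ne: "\<sigma> \<noteq> \<one>\<^bsub>aut_group V E\<^esub>" "\<tau> \<noteq> \<one>\<^bsub>aut_group V E\<^esub>"
    and disj: "disjoint_auts V \<sigma> \<tau>"
    by blast
  interpret disjoint_aut_pair V E \<sigma> \<tau>
    using assms auts disj by unfold_locales
  \<comment> \<open>Nontrivial automorphisms have order at least 2, so the construction applies with
    \<open>k = 2\<close>.\<close>
  let ?S = "{undefined} \<times> {..<2} :: ('v \<times> nat) set"
  have "irreducible_quantum_automorphism V E (l2_space ?S) (u ?S)"
    using two_le_elem_order[OF auts(1) ne(1)] two_le_elem_order[OF auts(2) ne(2)]
    by (intro irreducible_u) auto
  moreover have "\<not> has_dimension (l2_space ?S) 1"
    using has_dimension_l2_1_imp_eq[of ?S "(undefined, 0)" "(undefined, 1)"] by auto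
  ultimately show "has_quantum_symmetry V E"
    unfolding has_quantum_symmetry_def by blast
qed

end
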